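(* Suppose $\hat V\in C^2$ satisfies: (1) the HJB inequality $$\nabla\hat V(x)^\top f(x)-\tfrac12\nabla\hat V(x)^\top g(x)D^{-1}g(x)^\top\nabla\hat V(x)+q(x)\ \ge\ 0$$ (or equivalently the linear matrix inequality $\begin{bmatrix}2(\nabla\hat V(x)^\top f(x)+q(x))&\nabla\hat V(x)^\top g(x)\\ g(x)^\top\nabla\hat V(x)&D\end{bmatrix}\succeq0$) on a neighbourhood of the origin; (2) the Riccati Hessian constraint $\nabla^2\hat V(0)=P\succ0$; (3) the equilibrium constraints $\hat V(0)=0$ and $\nabla\hat V(0)=0$. Suppose further that $q$ is locally quadratically positive definite, i.e. there exist constants $c_q>0$ and $r_q>0$ such that $q(x)\ge c_q\|x\|^2$ for all $\|x\|<r_q$. Then there exist constants $\alpha,\beta,r>0$ such that for all $x_0$ with $\|x_0\|<r$, the closed-loop trajectory $x(t)$ of $\dot x=f(x)+g(x)\hat u(x)$, $x(0)=x_0$, under $\hat u(x)=-D^{-1}g(x)^\top\nabla\hat V(x)$ satisfies $$\|x(t)\|\le\alpha\|x_0\|e^{-\beta t},\qquad\forall t\ge0,$$ with $\beta\ge c_q/\lambda_{\max}(P)$ asymptotically near the origin.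
   Context: Consider the control-affine system $\dot x=f(x)+g(x)u$, $x\in\mathbb{R}^n$, $u\in\mathbb{R}^m$, with smooth $f:\mathbb{R}^n\to\mathbb{R}^n$, $g:\mathbb{R}^n\to\mathbb{R}^{n\times m}$, and cost $J(x_0,u)=\int_0^\infty[q(x(t))+\tfrac12u(t)^\top Du(t)]\,dt$ with $q:\mathbb{R}^n\to\mathbb{R}_{\ge0}$ and $D\in\mathbb{R}^{m\times m}$ symmetric positive definite. Standing assumptions: $f,g,q$ are at least $C^2$; $f(0)=0$; $q(0)=0$ and $q(x)>0$ for $x\ne0$; with $A=\frac{\partial f}{\partial x}\big|_{x=0}$, $B=g(0)$, $Q=\nabla^2q(0)$, the pair $(A,B)$ is stabilizable and the pair $(A,Q^{1/2})$ is detectable. $P$ denotes the solution of the algebraic Riccati equation $A^\top P+PA-PBD^{-1}B^\top P+Q=0$ and $\lambda_{\max}(P)$ its largest eigenvalue. *)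

theory Defs
  imports "HOL-Analysis.Analysis"
begin

section \<open>Twice continuously differentiable maps, gradient, Hessian\<close>

definition C2 :: "('a::real_normed_vector \<Rightarrow> 'b::real_normed_vector) \<Rightarrow> bool" where
  "C2 F \<longleftrightarrow> (\<exists>F' :: 'a \<Rightarrow> 'a \<Rightarrow>\<^sub>L 'b. \<exists>F'' :: 'a \<Rightarrow> 'a \<Rightarrow>\<^sub>L 'a \<Rightarrow>\<^sub>L 'b.
     (\<forall>x. (F has_derivative blinfun_apply (F' x)) (at x)) \<and>
     (\<forall>x. (F' has_derivative blinfun_apply (F'' x)) (at x)) \<and>
     continuous_on UNIV F'')"

definition grad :: "(real^'n \<Rightarrow> real) \<Rightarrow> real^'n \<Rightarrow> real^'n" where
  "grad V x = (\<chi> i. frechet_derivative V (at x) (axis i 1))"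

definition hessian :: "(real^'n \<Rightarrow> real) \<Rightarrow> real^'n \<Rightarrow> real^'n^'n" where
  "hessian V x = jacobian (grad V) (at x)"


section \<open>Matrices\<close>

definition pos_semidef :: "real^'n^'n \<Rightarrow> bool" where
  "pos_semidef M \<longleftrightarrow> transpose M = M \<and> (\<forall>v. v \<bullet> (M *v v) \<ge> 0)"

definition pos_def :: "real^'n^'n \<Rightarrow> bool" where
  "pos_def M \<longleftrightarrow> transpose M = M \<and> (\<forall>v. v \<noteq> 0 \<longrightarrow> v \<bullet> (M *v v) > 0)"

text \<open>The principal square root; the description denotes exactly when \<open>M\<close> is positive semidefinite.\<close>
definition psd_sqrt :: "real^'n^'n \<Rightarrow> real^'n^'n" where
  "psd_sqrt M = (THE S. pos_semidef S \<and> S ** S = M)"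

text \<open>Largest real eigenvalue. The set is finite, and it is nonempty when \<open>M\<close> is symmetric.\<close>
definition lambda_max :: "real^'n^'n \<Rightarrow> real" where
  "lambda_max M = Max {l. \<exists>v. v \<noteq> 0 \<and> M *v v = l *\<^sub>R v}"

text \<open>\<open>Hurwitz\<close> quantifies over the complex eigenvalues of the real matrix \<open>M\<close>.\<close>
definition Hurwitz :: "real^'n^'n \<Rightarrow> bool" where
  "Hurwitz M \<longleftrightarrow> (\<forall>(l::complex) (v::complex^'n).
     v \<noteq> 0 \<and> map_matrix complex_of_real M *v v = l *s v \<longrightarrow> Re l < 0)"

definition stabilizable :: "real^'n^'n \<Rightarrow> real^'m^'n \<Rightarrow> bool" where
  "stabilizable A B \<longleftrightarrow> (\<exists>K :: real^'n^'m. Hurwitz (A + B ** K))"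

definition detectable :: "real^'n^'n \<Rightarrow> real^'n^'p \<Rightarrow> bool" where
  "detectable A C \<longleftrightarrow> (\<exists>L :: real^'p^'n. Hurwitz (A + L ** C))"

text \<open>The block matrix with scalar \<open>a\<close>, row \<open>b\<close>, column \<open>b\<close> and square block \<open>D\<close>,
  indexed by the disjoint sum of a one-point type and \<open>'m\<close>.\<close>
definition bordered_matrix :: "real \<Rightarrow> real^'m \<Rightarrow> real^'m^'m \<Rightarrow> real^(unit + 'm)^(unit + 'm)" where
  "bordered_matrix a b D = (\<chi> i j. case i of
       Inl _ \<Rightarrow> (case j of Inl _ \<Rightarrow> a | Inr l \<Rightarrow> b $ l)
     | Inr k \<Rightarrow> (case j of Inl _ \<Rightarrow> b $ k | Inr l \<Rightarrow> D $ k $ l))"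


section \<open>Optimal control of control-affine systems\<close>

definition riccati_equation ::
  "real^'n^'n \<Rightarrow> real^'m^'n \<Rightarrow> real^'n^'n \<Rightarrow> real^'m^'m \<Rightarrow> real^'n^'n \<Rightarrow> bool" where
  "riccati_equation A B Q D P \<longleftrightarrow>
     transpose A ** P + P ** A - P ** B ** matrix_inv D ** transpose B ** P + Q = 0"

definition hjb_inequality ::
  "(real^'n \<Rightarrow> real^'n) \<Rightarrow> (real^'n \<Rightarrow> real^'m^'n) \<Rightarrow> (real^'n \<Rightarrow> real) \<Rightarrow> real^'m^'m \<Rightarrow>
   (real^'n \<Rightarrow> real) \<Rightarrow> real^'n \<Rightarrow> bool" where
  "hjb_inequality f g q D V x \<longleftrightarrow>
     grad V x \<bullet> f x
     - 1/2 * (grad V x \<bullet> ((g x ** matrix_inv D ** transpose (g x)) *v grad V x))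
     + q x \<ge> 0"

definition hjb_lmi ::
  "(real^'n \<Rightarrow> real^'n) \<Rightarrow> (real^'n \<Rightarrow> real^'m^'n) \<Rightarrow> (real^'n \<Rightarrow> real) \<Rightarrow> real^'m^'m \<Rightarrow>
   (real^'n \<Rightarrow> real) \<Rightarrow> real^'n \<Rightarrow> bool" where
  "hjb_lmi f g q D V x \<longleftrightarrow>
     pos_semidef (bordered_matrix (2 * (grad V x \<bullet> f x + q x)) (transpose (g x) *v grad V x) D)"

definition feedback ::
  "(real^'n \<Rightarrow> real^'m^'n) \<Rightarrow> real^'m^'m \<Rightarrow> (real^'n \<Rightarrow> real) \<Rightarrow> real^'n \<Rightarrow> real^'m" where
  "feedback g D V x = - (matrix_inv D *v (transpose (g x) *v grad V x))"

definition closed_loop_trajectory ::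
  "(real^'n \<Rightarrow> real^'n) \<Rightarrow> (real^'n \<Rightarrow> real^'m^'n) \<Rightarrow> (real^'n \<Rightarrow> real^'m) \<Rightarrow>
   real^'n \<Rightarrow> (real \<Rightarrow> real^'n) \<Rightarrow> bool" where
  "closed_loop_trajectory f g u x0 x \<longleftrightarrow>
     x 0 = x0 \<and>
     (\<forall>t\<ge>0. (x has_vector_derivative (f (x t) + g (x t) *v u (x t))) (at t within {0..}))"

end

theory Submission
  imports Defs
begin

text \<open>The Lyapunov function is the quadratic form \<open>x \<bullet> P x\<close>. By the Riccati equation its derivative along
  the linearized closed loop \<open>A - B D\<^sup>-\<^sup>1 B\<^sup>T P\<close> is at most \<open>- (x \<bullet> Q x)\<close>, and the quadratic lower bound on
  \<open>q\<close> gives \<open>x \<bullet> Q x \<ge> 2 c\<^sub>q \<parallel>x\<parallel>\<^sup>2\<close> by a second-order expansion at \<open>0\<close>. Since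
  \<open>x \<bullet> P x \<le> \<lambda>\<^sub>m\<^sub>a\<^sub>x(P) \<parallel>x\<parallel>\<^sup>2\<close>, the nonlinear closed loop decays near \<open>0\<close> at every rate
  below \<open>c\<^sub>q / \<lambda>\<^sub>m\<^sub>a\<^sub>x(P)\<close>, with overshoot the square root of the ratio of the extreme values of the
  form on the unit sphere. The equivalence of the two forms of the HJB condition is a Schur
  complement.\<close>

section \<open>Picard solutions on the half line\<close>

lemma integral_has_vector_derivative_atLeast:
  fixes h :: "real \<Rightarrow> 'a::banach"
  assumes "continuous_on {a..} h" "a \<le> t"
  shows "((\<lambda>u. integral {a..u} h) has_vector_derivative h t) (at t within {a..})"
proof -
  \<comment> \<open>The margin up to \<open>t + 1\<close> leaves room to the right of
    \<open>t\<close>, so that this filter agrees with the one on the half line.\<close>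
  have "((\<lambda>u. integral {a..u} h) has_vector_derivative h t) (at t within {a..t+1})"
    by (rule integral_has_vector_derivative)
      (use assms in \<open>auto intro: continuous_on_subset\<close>)
  moreover have "at t within {a..t+1} = at t within {a..}"
    by (rule at_within_nhd[of _ "{..<t+1}"]) auto
  ultimately show ?thesis by simp
qed

text \<open>Integrating the weight \<open>exp (k * s)\<close> gains a factor \<open>1 / k\<close>.
  This factor turns the Lipschitz constant \<open>L\<close> of the field into the contraction
  constant \<open>L / k\<close> of the Picard operator.\<close>

lemma integral_exp_growth_bound:
  fixes h :: "real \<Rightarrow> 'a::banach"
  assumes h: "continuous_on {0..} h" and M: "M \<ge> 0" and k: "k > 0"
    and bound: "\<And>s. s \<ge> 0 \<Longrightarrow> norm (h s) \<le> M * exp (k * s)" and t: "t \<ge> 0"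
  shows "norm (integral {0..t} h) \<le> M / k * exp (k * t)"
proof -
  have I: "((\<lambda>s. M * exp (k * s)) has_integral (M / k * exp (k * t) - M / k * exp (k * 0))) {0..t}"
    by (rule fundamental_theorem_of_calculus)
      (use t k in \<open>auto intro!: derivative_eq_intros
          simp flip: has_real_derivative_iff_has_vector_derivative\<close>)
  have "norm (integral {0..t} h) \<le> integral {0..t} (\<lambda>s. M * exp (k * s))"
    by (rule integral_norm_bound_integral)
      (use bound I in \<open>auto intro!: integrable_continuous_interval continuous_on_subset[OF h]
          simp: has_integral_integrable\<close>)
  also have "\<dots> = M / k * exp (k * t) - M / k" unfolding integral_unique[OF I] by simp
  also have "\<dots> \<le> M / k * exp (k * t)" using M k by simp
  finally show ?thesis .
qed

text \<open>In the supremum norm weighted by \<open>exp (- k * t)\<close> with \<open>k > L\<close> the Picard operator contracts on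
  the whole half line, so no continuation argument is needed.\<close>
lemma lipschitz_ode_solution_exists:
  fixes G :: "'a::banach \<Rightarrow> 'a"
  assumes G: "L-lipschitz_on UNIV G"
  obtains x where "x 0 = x0"
    and "\<And>t. t \<ge> 0 \<Longrightarrow> (x has_vector_derivative G (x t)) (at t within {0..})"
proof -
  have L: "L \<ge> 0" using G by (rule lipschitz_on_nonneg)
  define k where "k = L + 1"
  have k: "k > 0" "L / k < 1" using L by (auto simp: k_def)
  \<comment> \<open>The unknown \<open>y\<close> is the solution damped by
    \<open>exp (- k * t)\<close>. The damping brings exponentially growing solutions into the
    complete space of bounded continuous functions; \<open>H\<close> undoes it inside
    \<open>G\<close>.\<close>
  define H where "H y s = G (exp (k * s) *\<^sub>R apply_bcontfun y s)" for y :: "real \<Rightarrow>\<^sub>C 'a" and s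
  define J where "J y t = integral {0..t} (H y)" for y t
  \<comment> \<open>Bounded continuous functions live on the whole real line; \<open>max 0 t\<close>
    extends the operator to negative times by the constant \<open>x0\<close>.\<close>
  define \<Phi> where "\<Phi> y t = exp (- k * max 0 t) *\<^sub>R (x0 + J y (max 0 t))" for y t
  have contH: "continuous_on S (H y)" for S y
    unfolding H_def
    by (rule continuous_on_compose2[OF lipschitz_on_continuous_on[OF G]])
      (auto intro!: continuous_intros)
  have derivJ: "(J y has_vector_derivative H y t) (at t within {0..})" if "t \<ge> 0" for y t
    unfolding J_def by (rule integral_has_vector_derivative_atLeast[OF contH that])
  have contJ: "continuous_on {0..} (J y)" for y
    using derivJ by (auto simp: continuous_on_eq_continuous_within
        intro: has_vector_derivative_continuous)
  have cont\<Phi>: "continuous_on UNIV (\<Phi> y)" for y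
    unfolding \<Phi>_def
    by (intro continuous_intros continuous_on_compose2[OF contJ]) auto
  have bound\<Phi>: "norm (\<Phi> y t) \<le> norm x0 + (norm (G 0) + L * norm y) / k" for y t
  proof -
    let ?s = "max 0 t" and ?M = "norm (G 0) + L * norm y"
    have "norm (H y s) \<le> ?M * exp (k * s)" if "s \<ge> 0" for s
    proof -
      have "norm (H y s - G 0) \<le> L * norm (exp (k * s) *\<^sub>R apply_bcontfun y s)"
        unfolding H_def
        using lipschitz_on_normD[OF G UNIV_I UNIV_I, of "exp (k * s) *\<^sub>R apply_bcontfun y s" 0]
        by (simp del: norm_scaleR)
      also have "\<dots> \<le> L * (exp (k * s) * norm y)"
        using L by (auto intro!: mult_left_mono norm_bounded)
      finally have "norm (H y s) \<le> norm (G 0) * 1 + L * norm y * exp (k * s)"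
        using norm_triangle_sub[of "H y s" "G 0"] by (simp add: mult_ac)
      also have "norm (G 0) * 1 \<le> norm (G 0) * exp (k * s)"
        using k that by (intro mult_left_mono) auto
      finally show ?thesis by (simp add: algebra_simps)
    qed
    then have J: "norm (J y ?s) \<le> ?M / k * exp (k * ?s)"
      unfolding J_def using L k by (intro integral_exp_growth_bound contH) auto
    have "norm (\<Phi> y t) \<le> exp (- k * ?s) * (norm x0 + ?M / k * exp (k * ?s))"
      unfolding \<Phi>_def using J norm_triangle_ineq[of x0 "J y ?s"]
      by (auto intro!: mult_left_mono)
    also have "\<dots> = exp (- k * ?s) * norm x0 + ?M / k"
      by (simp add: algebra_simps exp_minus)
    also have "exp (- k * ?s) * norm x0 \<le> 1 * norm x0"
      using k by (intro mult_right_mono) auto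
    finally show ?thesis by simp
  qed
  define T where "T y = Bcontfun (\<Phi> y)" for y
  have T: "apply_bcontfun (T y) = \<Phi> y" for y
    unfolding T_def by (intro Bcontfun_inverse bcontfun_normI[OF cont\<Phi> bound\<Phi>])
  have contract: "dist (T y) (T z) \<le> L / k * dist y z" for y z
  proof (rule dist_bound)
    fix t :: real
    let ?s = "max 0 t"
    have "norm (H y s - H z s) \<le> L * dist y z * exp (k * s)" for s
    proof -
      have "norm (H y s - H z s)
          \<le> L * norm (exp (k * s) *\<^sub>R (apply_bcontfun y s - apply_bcontfun z s))"
        unfolding H_def using lipschitz_on_normD[OF G]
        by (simp del: norm_scaleR add: scaleR_diff_right)
      also have "\<dots> \<le> L * (exp (k * s) * dist y z)"
        using L dist_bounded[of y s z] by (auto intro!: mult_left_mono simp: dist_norm)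
      finally show ?thesis by (simp add: mult_ac)
    qed
    then have "norm (integral {0..?s} (\<lambda>s. H y s - H z s)) \<le> L * dist y z / k * exp (k * ?s)"
      using L k by (intro integral_exp_growth_bound continuous_intros contH) auto
    moreover have "integral {0..?s} (\<lambda>s. H y s - H z s) = J y ?s - J z ?s"
      unfolding J_def
      by (intro Henstock_Kurzweil_Integration.integral_diff integrable_continuous_interval contH)
    ultimately have J: "norm (J y ?s - J z ?s) \<le> L * dist y z / k * exp (k * ?s)" by simp
    have "dist (\<Phi> y t) (\<Phi> z t) = exp (- k * ?s) * norm (J y ?s - J z ?s)"
      unfolding \<Phi>_def dist_norm scaleR_diff_right[symmetric] by simp
    also have "\<dots> \<le> exp (- k * ?s) * (L * dist y z / k * exp (k * ?s))"
      using J by (intro mult_left_mono) auto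
    also have "\<dots> = L / k * dist y z" by (simp add: exp_minus)
    finally show "dist (apply_bcontfun (T y) t) (apply_bcontfun (T z) t) \<le> L / k * dist y z"
      by (simp add: T)
  qed
  obtain y where y: "T y = y"
    using banach_fix_type[of "L / k" T] contract L k by auto
  \<comment> \<open>Undoing the damping turns the fixed point into a solution of the integral
    equation.\<close>
  define x where "x t = exp (k * t) *\<^sub>R apply_bcontfun y t" for t
  have x: "x t = x0 + J y t" if "t \<ge> 0" for t
  proof -
    have "apply_bcontfun y t = exp (- k * t) *\<^sub>R (x0 + J y t)"
      using T[of y] y that by (simp add: \<Phi>_def max_def)
    then show ?thesis by (simp add: x_def exp_minus)
  qed
  show thesis
  proof
    show "x 0 = x0" using x[of 0] by (simp add: J_def)
    fix t :: real assume t: "t \<ge> 0"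
    have "((\<lambda>t. x0 + J y t) has_vector_derivative G (x t)) (at t within {0..})"
      using derivJ[OF t, of y] by (auto intro!: derivative_eq_intros simp: H_def x_def)
    then show "(x has_vector_derivative G (x t)) (at t within {0..})"
      by (rule has_vector_derivative_transform[rotated 2]) (use t x in auto)
  qed
qed

section \<open>Quadratic forms\<close>

lemma inner_matrix_vector_transpose:
  fixes M :: "real^'n^'m"
  shows "x \<bullet> (M *v y) = (transpose M *v x) \<bullet> y"
  by (simp add: dot_lmul_matrix)

text \<open>A zero of a nonnegative form is a minimizer. A small step along
  \<open>- (M *v v)\<close> would lower the form to first order unless
  \<open>M *v v = 0\<close>.\<close>

lemma pos_semidef_kernel:
  assumes M: "pos_semidef M" and v: "v \<bullet> (M *v v) = 0"
  shows "M *v v = 0"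
proof (rule ccontr)
  assume nz: "M *v v \<noteq> 0"
  define w where "w = M *v v"
  define a where "a = w \<bullet> w"
  define b where "b = w \<bullet> (M *v w)"
  have a: "a > 0" using nz by (simp add: a_def w_def)
  have b: "b \<ge> 0" using M by (simp add: b_def pos_semidef_def)
  \<comment> \<open>At this step length the gain \<open>2 * s * a\<close> outweighs the cost
    \<open>s\<^sup>2 * b\<close>, which is at most \<open>s * a\<close>; the \<open>+ 1\<close>
    covers \<open>b = 0\<close>.\<close>
  define s where "s = a / (b + 1)"
  have "v \<bullet> (M *v w) = a"
    using M by (simp only: inner_matrix_vector_transpose pos_semidef_def a_def w_def)
  then have "(v - s *\<^sub>R w) \<bullet> (M *v (v - s *\<^sub>R w)) = s\<^sup>2 * b - 2 * s * a"
    using v by (simp add: matrix_vector_mult_diff_distrib matrix_vector_mult_scaleR inner_diff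
        a_def b_def power2_eq_square algebra_simps flip: w_def)
  then have "2 * s * a \<le> s\<^sup>2 * b" using M unfolding pos_semidef_def by (metis diff_ge_0_iff_ge)
  also have "\<dots> = s * (a * (b / (b + 1)))" by (simp add: s_def power2_eq_square)
  also have "\<dots> \<le> s * (a * 1)"
    using a b by (intro mult_left_mono) (auto simp: s_def)
  finally have "s * a \<le> 0" by (simp add: mult.commute)
  moreover have "s * a > 0" using a b by (simp add: s_def)
  ultimately show False by simp
qed

text \<open>Eigenvectors of a symmetric matrix for distinct eigenvalues are orthogonal, and an
  orthogonal family in finite dimension is finite. This makes \<open>Max\<close> in
  \<open>lambda_max\<close> usable.\<close>

lemma finite_eigenvalues_symmetric:
  fixes M :: "real^'n^'n"
  assumes M: "transpose M = M"
  shows "finite {l. \<exists>v. v \<noteq> 0 \<and> M *v v = l *\<^sub>R v}" (is "finite ?E")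
proof -
  obtain e where e: "\<And>l. l \<in> ?E \<Longrightarrow> e l \<noteq> 0 \<and> M *v e l = l *\<^sub>R e l"
    using bchoice[of ?E "\<lambda>l v. v \<noteq> 0 \<and> M *v v = l *\<^sub>R v"] by blast
  have orth: "e l \<bullet> e m = 0" if "l \<in> ?E" "m \<in> ?E" "l \<noteq> m" for l m
  proof -
    have "e l \<bullet> (M *v e m) = (M *v e l) \<bullet> e m"
      by (simp only: inner_matrix_vector_transpose M)
    then show ?thesis using e[of l] e[of m] that by simp
  qed
  have "finite (e ` ?E)"
    by (rule pairwise_orthogonal_imp_finite)
      (auto simp: pairwise_image pairwise_def orthogonal_def intro!: orth)
  moreover have "inj_on e ?E"
    by (rule inj_onI) (metis (no_types, lifting) e orth inner_eq_zero_iff)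
  ultimately show ?thesis by (rule finite_imageD)
qed

text \<open>Rayleigh quotient argument: if \<open>l\<close> is the maximum of the form on the unit
  sphere, then \<open>l *\<^sub>R mat 1 - M\<close> is positive semidefinite and its form vanishes
  at the maximizer. By \<open>pos_semidef_kernel\<close> the maximizer is an eigenvector, so
  \<open>l\<close> is one of the eigenvalues.\<close>

lemma inner_le_lambda_max:
  fixes M :: "real^'n^'n"
  assumes M: "transpose M = M"
  shows "x \<bullet> (M *v x) \<le> lambda_max M * (norm x)\<^sup>2"
proof -
  have "axis undefined 1 \<in> sphere (0::real^'n) 1" by simp
  then have "sphere (0::real^'n) 1 \<noteq> {}" by blast
  moreover have cont: "continuous_on (sphere 0 1) (\<lambda>y. y \<bullet> (M *v y))"
    by (intro continuous_intros)
  ultimately obtain v where v: "norm v = 1" and max: "\<And>y. norm y = 1 \<Longrightarrow> y \<bullet> (M *v y) \<le> v \<bullet> (M *v v)"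
    using continuous_attains_sup[OF compact_sphere _ cont] by fastforce
  define l where "l = v \<bullet> (M *v v)"
  have le: "y \<bullet> (M *v y) \<le> l * (norm y)\<^sup>2" for y
  proof (cases "y = 0")
    case False
    with max[of "y /\<^sub>R norm y"] show ?thesis
      by (simp add: l_def matrix_vector_mult_scaleR field_simps power2_eq_square)
  qed simp
  have shift: "(l *\<^sub>R mat 1 - M) *v y = l *\<^sub>R y - M *v y" for y
    by (simp add: matrix_vector_mult_diff_rdistrib flip: scaleR_matrix_vector_assoc)
  have "M $ i $ j = M $ j $ i" for i j
    using M unfolding transpose_def by (metis vec_lambda_beta)
  then have "transpose (l *\<^sub>R mat 1 - M) = l *\<^sub>R mat 1 - M"
    by (auto simp: transpose_def vec_eq_iff mat_def)
  then have "pos_semidef (l *\<^sub>R mat 1 - M)"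
    unfolding pos_semidef_def shift using le
    by (simp add: inner_diff_right power2_norm_eq_inner)
  moreover have "v \<bullet> ((l *\<^sub>R mat 1 - M) *v v) = 0"
    unfolding shift using v by (simp add: inner_diff_right l_def flip: power2_norm_eq_inner)
  ultimately have "M *v v = l *\<^sub>R v" using pos_semidef_kernel shift by force
  then have "l \<le> lambda_max M"
    unfolding lambda_max_def using v
    by (intro Max_ge finite_eigenvalues_symmetric[OF M]) (force intro: exI[of _ v])
  then show ?thesis using le[of x] by (meson mult_right_mono order_trans zero_le_power2)
qed

text \<open>The constant is the minimum of the form over the compact unit sphere; homogeneity of
  degree two carries the bound to all vectors.\<close>

lemma pos_def_lower_bound:
  fixes M :: "real^'n^'n"
  assumes M: "pos_def M"
  obtains \<mu> where "\<mu> > 0" "\<And>x. \<mu> * (norm x)\<^sup>2 \<le> x \<bullet> (M *v x)"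
proof -
  have "axis undefined 1 \<in> sphere (0::real^'n) 1" by simp
  then have "sphere (0::real^'n) 1 \<noteq> {}" by blast
  moreover have cont: "continuous_on (sphere 0 1) (\<lambda>y. y \<bullet> (M *v y))"
    by (intro continuous_intros)
  ultimately obtain v where v: "norm v = 1" and min: "\<And>y. norm y = 1 \<Longrightarrow> v \<bullet> (M *v v) \<le> y \<bullet> (M *v y)"
    using continuous_attains_inf[OF compact_sphere _ cont] by fastforce
  show thesis
  proof
    show "v \<bullet> (M *v v) > 0" using M v unfolding pos_def_def by (metis norm_zero zero_neq_one)
    fix y show "v \<bullet> (M *v v) * (norm y)\<^sup>2 \<le> y \<bullet> (M *v y)"
    proof (cases "y = 0")
      case False
      with min[of "y /\<^sub>R norm y"] show ?thesis
        by (simp add: matrix_vector_mult_scaleR field_simps power2_eq_square)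
    qed simp
  qed
qed

lemma pos_def_inverse:
  assumes D: "pos_def D"
  shows "D *v (matrix_inv D *v x) = x" and "x \<bullet> (matrix_inv D *v x) \<ge> 0"
proof -
  have "inj ((*v) D)"
  proof (rule injI)
    fix x y assume "D *v x = D *v y"
    then have "D *v (x - y) = 0" by (simp add: matrix_vector_mult_diff_distrib)
    then show "x = y" using D unfolding pos_def_def
      by (metis inner_zero_right less_irrefl right_minus_eq)
  qed
  then have "invertible D"
    by (simp add: invertible_left_inverse matrix_left_invertible_injective)
  then have R: "D ** matrix_inv D = mat 1"
    unfolding invertible_def matrix_inv_def by (metis (mono_tags, lifting) someI_ex)
  show x: "D *v (matrix_inv D *v x) = x" for x by (simp add: matrix_vector_mul_assoc R)
  \<comment> \<open>Writing \<open>x\<close> as the image under \<open>D\<close> of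
    \<open>matrix_inv D *v x\<close> reduces the form of the inverse to the form of
    \<open>D\<close>.\<close>
  have "x \<bullet> (matrix_inv D *v x) = (matrix_inv D *v x) \<bullet> (D *v (matrix_inv D *v x))"
    by (simp add: x inner_commute)
  then show "x \<bullet> (matrix_inv D *v x) \<ge> 0"
    using D unfolding pos_def_def by (metis inner_zero_left order.refl order.strict_implies_order)
qed

section \<open>Schur complement and the matrix inequality\<close>

lemma sum_UNIV_Plus:
  fixes h :: "'a::finite + 'b::finite \<Rightarrow> 'c::comm_monoid_add"
  shows "sum h UNIV = (\<Sum>a\<in>UNIV. h (Inl a)) + (\<Sum>b\<in>UNIV. h (Inr b))"
  using sum.Plus[of UNIV UNIV h] by simp

lemma bordered_matrix_quadratic_form:
  fixes D :: "real^'m^'m" and z :: "real^(unit + 'm)"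
  shows "z \<bullet> (bordered_matrix a b D *v z)
    = a * (z $ Inl ())\<^sup>2 + 2 * (z $ Inl ()) * (b \<bullet> (\<chi> k. z $ Inr k))
      + (\<chi> k. z $ Inr k) \<bullet> (D *v (\<chi> k. z $ Inr k))"
proof -
  define s where "s = z $ Inl ()"
  define w where "w = (\<chi> k. z $ Inr k)"
  define y where "y = bordered_matrix a b D *v z"
  have "y $ Inl () = a * s + b \<bullet> w"
    by (simp add: y_def matrix_vector_mult_def bordered_matrix_def sum_UNIV_Plus UNIV_unit
        inner_vec_def s_def w_def)
  moreover have "(\<chi> k. y $ Inr k) = s *\<^sub>R b + D *v w"
    by (simp add: y_def matrix_vector_mult_def bordered_matrix_def sum_UNIV_Plus UNIV_unit
        vec_eq_iff s_def w_def)
  moreover have "z \<bullet> y = s * y $ Inl () + w \<bullet> (\<chi> k. y $ Inr k)"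
    by (simp add: inner_vec_def sum_UNIV_Plus UNIV_unit s_def w_def)
  ultimately have "z \<bullet> y = a * s\<^sup>2 + 2 * s * (b \<bullet> w) + w \<bullet> (D *v w)"
    by (simp add: inner_add_right inner_commute[of w b] power2_eq_square algebra_simps)
  then show ?thesis by (simp add: y_def s_def w_def)
qed

text \<open>Completing the square: with \<open>c = matrix_inv D *v b\<close>, the form at scalar
  part \<open>s\<close> and block part \<open>w\<close> is
  \<open>s\<^sup>2 * (a - b \<bullet> c)\<close> plus the form of \<open>D\<close> at
  \<open>w + s *\<^sub>R c\<close>.\<close>

lemma pos_semidef_bordered_matrix_iff:
  fixes D :: "real^'m^'m"
  assumes D: "pos_def D"
  shows "pos_semidef (bordered_matrix a b D) \<longleftrightarrow> b \<bullet> (matrix_inv D *v b) \<le> a"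
proof
  note inv = pos_def_inverse[OF D]
  define c where "c = matrix_inv D *v b"
  have Dc: "D *v c = b" by (simp add: c_def inv)
  {
    assume psd: "pos_semidef (bordered_matrix a b D)"
    \<comment> \<open>With scalar part \<open>1\<close> and block part \<open>- c\<close> the
      completed square vanishes, leaving exactly the Schur complement.\<close>
    define z :: "real^(unit + 'm)" where "z = (\<chi> i. case i of Inl _ \<Rightarrow> 1 | Inr k \<Rightarrow> - c $ k)"
    have "(\<chi> k. z $ Inr k) = - c" "z $ Inl () = 1" by (simp_all add: z_def vec_eq_iff)
    moreover have "D *v (- c) = - b" using Dc by (metis linear_neg matrix_vector_mul_linear)
    ultimately have "z \<bullet> (bordered_matrix a b D *v z) = a - b \<bullet> c"
      unfolding bordered_matrix_quadratic_form by (simp add: inner_commute)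
    then show "b \<bullet> (matrix_inv D *v b) \<le> a"
      using psd unfolding pos_semidef_def c_def by (metis diff_ge_0_iff_ge)
  }
  assume le: "b \<bullet> (matrix_inv D *v b) \<le> a"
  have "z \<bullet> (bordered_matrix a b D *v z) \<ge> 0" for z
  proof -
    define s where "s = z $ Inl ()"
    define w where "w = (\<chi> k. z $ Inr k)"
    have "c \<bullet> (D *v w) = b \<bullet> w"
      using D Dc by (simp only: inner_matrix_vector_transpose pos_def_def)
    then have "z \<bullet> (bordered_matrix a b D *v z)
        = s\<^sup>2 * (a - b \<bullet> c) + (w + s *\<^sub>R c) \<bullet> (D *v (w + s *\<^sub>R c))"
      unfolding bordered_matrix_quadratic_form s_def[symmetric] w_def[symmetric]
      by (simp add: matrix_vector_right_distrib matrix_vector_mult_scaleR Dc inner_add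
          inner_commute power2_eq_square algebra_simps)
    moreover have "(w + s *\<^sub>R c) \<bullet> (D *v (w + s *\<^sub>R c)) \<ge> 0"
      using D unfolding pos_def_def by (metis inner_zero_left order.refl order.strict_implies_order)
    ultimately show ?thesis using le by (simp add: c_def)
  qed
  moreover have "transpose (bordered_matrix a b D) = bordered_matrix a b D"
  proof -
    have "D $ k $ l = D $ l $ k" for k l
      using D unfolding pos_def_def transpose_def by (metis vec_lambda_beta)
    then show ?thesis
      by (auto simp: transpose_def bordered_matrix_def vec_eq_iff split: sum.split)
  qed
  ultimately show "pos_semidef (bordered_matrix a b D)" by (simp add: pos_semidef_def)
qed

text \<open>The Schur complement of \<open>D\<close> in the bordered matrix is twice the left-hand
  side of the HJB inequality, which accounts for the factor 2 in the corner entry.\<close>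

lemma hjb_inequality_iff_hjb_lmi:
  assumes "pos_def D"
  shows "hjb_inequality f g q D V x \<longleftrightarrow> hjb_lmi f g q D V x"
proof -
  have "grad V x \<bullet> ((g x ** matrix_inv D ** transpose (g x)) *v grad V x)
      = (transpose (g x) *v grad V x) \<bullet> (matrix_inv D *v (transpose (g x) *v grad V x))"
    by (simp only: matrix_vector_mul_assoc[symmetric] inner_matrix_vector_transpose)
  then show ?thesis
    unfolding hjb_inequality_def hjb_lmi_def pos_semidef_bordered_matrix_iff[OF assms] by argo
qed

section \<open>Regularity of the data\<close>

text \<open>Compactness bounds the continuous derivative, and convexity lets the mean value
  inequality use that bound along segments.\<close>

lemma C1_lipschitz_on_compact:
  fixes h :: "'a::real_normed_vector \<Rightarrow> 'b::real_normed_vector"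
  assumes der: "\<And>x. (h has_derivative blinfun_apply (h' x)) (at x)"
    and cont: "continuous_on UNIV h'" and S: "compact S" "convex S"
  shows "\<exists>L. L-lipschitz_on S h"
proof -
  have "bounded (h' ` S)"
    by (intro compact_imp_bounded compact_continuous_image S continuous_on_subset[OF cont]) auto
  then obtain L where L: "L > 0" "\<And>x. x \<in> S \<Longrightarrow> norm (h' x) \<le> L"
    by (auto simp: bounded_pos)
  have "L-lipschitz_on S h"
  proof (rule lipschitz_onI)
    fix x y assume "x \<in> S" "y \<in> S"
    then show "dist (h x) (h y) \<le> L * dist x y"
      unfolding dist_norm using L S
      by (intro differentiable_bound[where f' = "\<lambda>x. blinfun_apply (h' x)"])
        (auto intro: has_derivative_at_withinI der simp flip: norm_blinfun.rep_eq)
  qed (use L in simp)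
  then show ?thesis by blast
qed

lemma (in bounded_linear) lipschitz_on_bounded_linear_compose:
  assumes "\<exists>L. L-lipschitz_on S h"
  shows "\<exists>L. L-lipschitz_on S (\<lambda>x. f (h x))"
proof -
  obtain K where "K-lipschitz_on (h ` S) f" by (rule lipschitz_boundE)
  with assms show ?thesis by (blast intro: lipschitz_on_compose2)
qed

text \<open>Varying one factor at a time leaves the other factor as a coefficient; it is bounded
  because continuous images of \<open>S\<close> are compact.\<close>

lemma (in bounded_bilinear) lipschitz_on_compact_prod:
  assumes a: "\<exists>L. L-lipschitz_on S a" and b: "\<exists>L. L-lipschitz_on S b" and S: "compact S"
  shows "\<exists>L. L-lipschitz_on S (\<lambda>x. prod (a x) (b x))"
proof -
  obtain L M where L: "L-lipschitz_on S a" and M: "M-lipschitz_on S b" using a b by blast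
  have "bounded (a ` S)" "bounded (b ` S)"
    by (intro compact_imp_bounded compact_continuous_image S
        lipschitz_on_continuous_on[OF L] lipschitz_on_continuous_on[OF M])+
  then obtain p q where p: "p > 0" "\<And>x. x \<in> S \<Longrightarrow> norm (a x) \<le> p"
    and q: "q > 0" "\<And>x. x \<in> S \<Longrightarrow> norm (b x) \<le> q"
    by (auto simp: bounded_pos)
  obtain K where K: "K \<ge> 0" "\<And>x y. norm (prod x y) \<le> norm x * norm y * K"
    using nonneg_bounded by blast
  have LM: "L \<ge> 0" "M \<ge> 0" using L M by (auto dest: lipschitz_on_nonneg)
  have "(p * M * K + L * q * K)-lipschitz_on S (\<lambda>x. prod (a x) (b x))"
  proof (rule lipschitz_onI)
    fix x y assume xy: "x \<in> S" "y \<in> S"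
    have "prod (a x) (b x) - prod (a y) (b y) = prod (a x) (b x - b y) + prod (a x - a y) (b y)"
      by (simp add: diff_left diff_right)
    then have "dist (prod (a x) (b x)) (prod (a y) (b y))
        \<le> norm (prod (a x) (b x - b y)) + norm (prod (a x - a y) (b y))"
      by (simp add: dist_norm norm_triangle_ineq)
    also have "\<dots> \<le> norm (a x) * norm (b x - b y) * K + norm (a x - a y) * norm (b y) * K"
      by (intro add_mono K)
    also have "\<dots> \<le> p * (M * dist x y) * K + L * dist x y * q * K"
      using xy p q K LM lipschitz_onD[OF L xy] lipschitz_onD[OF M xy]
      by (intro add_mono mult_mono) (auto simp: dist_norm)
    finally show "dist (prod (a x) (b x)) (prod (a y) (b y)) \<le> (p * M * K + L * q * K) * dist x y"
      by (simp add: algebra_simps)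
  qed (use p q K LM in simp)
  then show ?thesis by blast
qed

lemma bounded_bilinear_matrix_vector_mult:
  "bounded_bilinear (\<lambda>(M::real^'n^'m) x. M *v x)"
  unfolding bilinear_conv_bounded_bilinear[symmetric] bilinear_def
  by (auto intro!: linearI simp: matrix_vector_mult_add_rdistrib scaleR_matrix_vector_assoc
      matrix_vector_right_distrib matrix_vector_mult_scaleR)

lemma bounded_linear_transpose: "bounded_linear (transpose :: real^'n^'m \<Rightarrow> real^'m^'n)"
  by (intro linear_conv_bounded_linear[THEN iffD1] linearI)
    (auto simp: transpose_def vec_eq_iff)

section \<open>Derivatives, gradients and Hessians of C2 maps\<close>

lemma C2_imp_differentiable: "C2 h \<Longrightarrow> h differentiable (at x)"
  unfolding C2_def by (blast intro: differentiableI)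

lemma C2_lipschitz_on_compact:
  assumes "C2 h" "compact S" "convex S"
  shows "\<exists>L. L-lipschitz_on S h"
proof -
  obtain h' h'' where "\<And>x. (h has_derivative blinfun_apply (h' x)) (at x)"
    and h': "\<And>x. (h' has_derivative blinfun_apply (h'' x)) (at x)"
    using assms(1) unfolding C2_def by blast
  moreover have "continuous_on UNIV h'"
    using h' by (auto simp: continuous_on_eq_continuous_at intro: has_derivative_continuous)
  ultimately show ?thesis using assms(2,3) by (intro C1_lipschitz_on_compact)
qed

text \<open>The gradient is the derivative followed by a fixed linear map \<open>T\<close>, the
  Riesz isomorphism in coordinates, so it inherits the regularity of the derivative.\<close>

lemma
  fixes V :: "real^'n \<Rightarrow> real"
  assumes V: "C2 V"
  shows C2_has_derivative_grad: "(V has_derivative (\<lambda>h. grad V x \<bullet> h)) (at x)"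
    and C2_grad_differentiable: "grad V differentiable (at x)"
    and C2_grad_lipschitz_on_compact: "compact S \<Longrightarrow> convex S \<Longrightarrow> \<exists>L. L-lipschitz_on S (grad V)"
proof -
  obtain V' V'' where V': "\<And>x. (V has_derivative blinfun_apply (V' x)) (at x)"
    and V'': "\<And>x. (V' has_derivative blinfun_apply (V'' x)) (at x)"
    and cont: "continuous_on UNIV V''"
    using V unfolding C2_def by blast
  define T :: "((real^'n) \<Rightarrow>\<^sub>L real) \<Rightarrow> real^'n"
    where "T \<phi> = (\<Sum>i\<in>UNIV. blinfun_apply \<phi> (axis i 1) *\<^sub>R axis i 1)" for \<phi>
  have T: "bounded_linear T"
    unfolding T_def
    by (intro bounded_linear_sum bounded_linear_scaleR_const blinfun.bounded_linear_left)
  have fd: "frechet_derivative V (at x) = blinfun_apply (V' x)" for x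
    using frechet_derivative_at[OF V'] by simp
  have comp: "T \<phi> $ i = blinfun_apply \<phi> (axis i 1)" for \<phi> i
    by (simp add: T_def axis_def if_distrib cong: if_cong)
  have grad: "grad V = (\<lambda>x. T (V' x))"
    by (auto simp: grad_def fd vec_eq_iff comp)
  have "T \<phi> \<bullet> h = blinfun_apply \<phi> h" for \<phi> h
  proof -
    have "blinfun_apply \<phi> h = blinfun_apply \<phi> (\<Sum>i\<in>UNIV. h $ i *\<^sub>R axis i 1)"
      by (simp add: basis_expansion flip: scalar_mult_eq_scaleR)
    also have "\<dots> = T \<phi> \<bullet> h"
      by (simp add: blinfun.sum_right blinfun.scaleR_right inner_vec_def comp mult.commute)
    finally show ?thesis by simp
  qed
  then show "(V has_derivative (\<lambda>h. grad V x \<bullet> h)) (at x)"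
    using V' by (simp add: grad)
  show "grad V differentiable (at x)"
    unfolding grad
    by (rule differentiableI, rule bounded_linear.has_derivative[OF T V''])
  show "\<exists>L. L-lipschitz_on S (grad V)" if "compact S" "convex S"
    unfolding grad
    by (rule bounded_linear.lipschitz_on_bounded_linear_compose[OF T])
      (rule C1_lipschitz_on_compact[OF V'' cont that])
qed

text \<open>On each line through the origin the gap \<open>\<psi>\<close> between \<open>q\<close>
  and its quadratic minorant has a local minimum at \<open>0\<close>, which rules out a negative
  second derivative. The factor 2 is the second derivative of the square.\<close>

lemma hessian_lower_bound:
  fixes q :: "real^'n \<Rightarrow> real"
  assumes q: "C2 q" and q0: "q 0 = 0" and r: "r > 0"
    and low: "\<And>x. norm x < r \<Longrightarrow> q x \<ge> c * (norm x)\<^sup>2"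
  shows "2 * c * (norm h)\<^sup>2 \<le> h \<bullet> (hessian q 0 *v h)"
proof (rule ccontr)
  assume "\<not> ?thesis"
  then have l: "(hessian q 0 *v h) \<bullet> h - 2 * c * (norm h)\<^sup>2 < 0" by (simp add: inner_commute)
  define \<psi> where "\<psi> s = q (s *\<^sub>R h) - c * s\<^sup>2 * (norm h)\<^sup>2" for s
  define \<psi>' where "\<psi>' s = grad q (s *\<^sub>R h) \<bullet> h - 2 * c * s * (norm h)\<^sup>2" for s
  have der: "(\<psi> has_real_derivative \<psi>' s) (at s)" for s
  proof -
    have "((\<lambda>s. q (s *\<^sub>R h)) has_derivative (\<lambda>t. grad q (s *\<^sub>R h) \<bullet> (t *\<^sub>R h))) (at s)"
      by (rule has_derivative_compose[OF _ C2_has_derivative_grad[OF q]])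
        (auto intro!: derivative_eq_intros)
    then have "((\<lambda>s. q (s *\<^sub>R h)) has_real_derivative grad q (s *\<^sub>R h) \<bullet> h) (at s)"
      by (simp add: has_field_derivative_def mult_commute_abs)
    then show ?thesis unfolding \<psi>_def \<psi>'_def
      by (auto intro!: derivative_eq_intros)
  qed
  have "(grad q has_derivative (\<lambda>v. hessian q 0 *v v)) (at (0 *\<^sub>R h))"
    using C2_grad_differentiable[OF q, of 0] by (simp add: hessian_def jacobian_works)
  then have "((\<lambda>s. grad q (s *\<^sub>R h)) has_derivative (\<lambda>t. hessian q 0 *v (t *\<^sub>R h))) (at 0)"
    by (rule has_derivative_compose[rotated]) (auto intro!: derivative_eq_intros)
  then have "((\<lambda>s. grad q (s *\<^sub>R h) \<bullet> h) has_derivative (\<lambda>t. (hessian q 0 *v (t *\<^sub>R h)) \<bullet> h)) (at 0)"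
    by (rule has_derivative_inner_left)
  then have "((\<lambda>s. grad q (s *\<^sub>R h) \<bullet> h) has_real_derivative (hessian q 0 *v h) \<bullet> h) (at 0)"
    by (simp add: has_field_derivative_def mult_commute_abs matrix_vector_mult_scaleR)
  then have der': "(\<psi>' has_real_derivative (hessian q 0 *v h) \<bullet> h - 2 * c * (norm h)\<^sup>2) (at 0)"
    unfolding \<psi>'_def by (auto intro!: derivative_eq_intros)
  \<comment> \<open>For parameters below \<open>d\<close> in absolute value the point stays within
    radius \<open>r\<close>; the \<open>+ 1\<close> covers \<open>h = 0\<close>.\<close>
  define d where "d = r / (norm h + 1)"
  have d: "d > 0" using r by (simp add: d_def add_nonneg_pos)
  have nonneg: "\<psi> s \<ge> 0" if "\<bar>s\<bar> < d" for s
  proof -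
    have "\<bar>s\<bar> * norm h \<le> \<bar>s\<bar> * (norm h + 1)" by (intro mult_left_mono) auto
    also have "\<dots> < r" using that by (simp add: d_def pos_less_divide_eq add_nonneg_pos)
    finally show ?thesis using low[of "s *\<^sub>R h"] by (simp add: \<psi>_def power_mult_distrib mult_ac)
  qed
  have \<psi>0: "\<psi> 0 = 0" by (simp add: \<psi>_def q0)
  \<comment> \<open>The first derivative vanishes at the minimum, so a negative second derivative
    makes \<open>\<psi>'\<close> negative just to the right, and \<open>\<psi>\<close> would drop
    below \<open>0\<close> there.\<close>
  then have "\<psi>' 0 = 0"
    using nonneg by (intro DERIV_local_min[OF der d]) auto
  with DERIV_neg_dec_right[OF der' l] obtain e where e: "e > 0" "\<And>s. 0 < s \<Longrightarrow> s < e \<Longrightarrow> \<psi>' s < 0"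
    by auto
  define s where "s = min d e / 2"
  have s: "0 < s" "s < d" "s < e" using d e by (auto simp: s_def)
  have "\<psi> s < \<psi> 0"
  proof (rule DERIV_neg_imp_decreasing_open[OF s(1)])
    show "\<exists>y. DERIV \<psi> t :> y \<and> y < 0" if "0 < t" "t < s" for t
      using der[of t] e(2)[of t] that s by auto
    show "continuous_on {0..s} \<psi>"
      using der by (auto intro!: continuous_at_imp_continuous_on DERIV_isCont)
  qed
  then show False using nonneg[of s] s \<psi>0 by simp
qed

section \<open>Local exponential decay\<close>

text \<open>As long as the trajectory stays in the ball, the form multiplied by an integrating
  factor does not increase, and \<open>\<mu>\<close>, \<open>\<nu>\<close> convert this into a norm
  bound. A first-exit argument then shows that the trajectory never leaves.\<close>

lemma lyapunov_exponential_decay: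
  fixes H :: "real^'n \<Rightarrow> real^'n" and P :: "real^'n^'n"
  assumes P: "transpose P = P"
    and \<mu>: "\<mu> > 0" "\<And>y. \<mu> * (norm y)\<^sup>2 \<le> y \<bullet> (P *v y)"
    and \<nu>: "\<nu> > 0" "\<And>y. y \<bullet> (P *v y) \<le> \<nu> * (norm y)\<^sup>2"
    and \<beta>: "\<beta> \<ge> 0"
    and decay: "\<And>y. norm y \<le> \<delta> \<Longrightarrow> y \<bullet> (P *v H y) \<le> - \<beta> * (y \<bullet> (P *v y))"
    and x0: "norm (x 0) < \<delta>" "sqrt (\<nu> / \<mu>) * norm (x 0) < \<delta>"
    and x: "\<And>t. t \<ge> 0 \<Longrightarrow> (x has_vector_derivative H (x t)) (at t within {0..})"
    and t: "t \<ge> 0"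
  shows "norm (x t) < \<delta>"
    and "norm (x t) \<le> sqrt (\<nu> / \<mu>) * norm (x 0) * exp (- \<beta> * t)"
proof -
  have contx: "continuous_on {0..} x"
    using x by (auto simp: continuous_on_eq_continuous_within
        intro: has_vector_derivative_continuous)
  \<comment> \<open>Stated under confinement up to \<open>T\<close> only, since the bound itself is
    needed to prove confinement.\<close>
  have decay_while: "norm (x T) \<le> sqrt (\<nu> / \<mu>) * norm (x 0) * exp (- \<beta> * T)"
    if T: "T \<ge> 0" and inside: "\<And>s. 0 \<le> s \<Longrightarrow> s \<le> T \<Longrightarrow> norm (x s) \<le> \<delta>" for T
  proof -
    \<comment> \<open>The exponent is \<open>2 * \<beta>\<close> because, by symmetry of
      \<open>P\<close>, the form changes at twice the rate
      \<open>x s \<bullet> (P *v H (x s))\<close>.\<close>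
    define Z where "Z s = exp (2 * \<beta> * s) * (x s \<bullet> (P *v x s))" for s
    have "Z T \<le> Z 0"
    proof (rule DERIV_nonpos_imp_decreasing_open[OF T])
      fix s assume s: "0 < s" "s < T"
      have "at s within {0..} = at s"
        by (rule at_within_nhd[of _ "{0<..}"]) (use s in auto)
      then have dx: "(x has_vector_derivative H (x s)) (at s)" using x[of s] s by simp
      have "((\<lambda>s. x s \<bullet> (P *v x s)) has_vector_derivative
          x s \<bullet> (P *v H (x s)) + H (x s) \<bullet> (P *v x s)) (at s)"
        by (intro bounded_bilinear.has_vector_derivative[OF bounded_bilinear_inner] dx
            bounded_linear.has_vector_derivative[OF matrix_vector_mul_bounded_linear])
      moreover have "H (x s) \<bullet> (P *v x s) = x s \<bullet> (P *v H (x s))"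
        using inner_matrix_vector_transpose[of "x s" P "H (x s)"] P by (simp add: inner_commute)
      ultimately have "(Z has_real_derivative
          2 * exp (2 * \<beta> * s) * (x s \<bullet> (P *v H (x s)) + \<beta> * (x s \<bullet> (P *v x s)))) (at s)"
        unfolding Z_def has_real_derivative_iff_has_vector_derivative[symmetric]
        by (auto intro!: derivative_eq_intros simp: algebra_simps)
      moreover have "2 * exp (2 * \<beta> * s) * (x s \<bullet> (P *v H (x s)) + \<beta> * (x s \<bullet> (P *v x s))) \<le> 0"
        using decay[OF inside, of s] s by (intro mult_nonneg_nonpos) auto
      ultimately show "\<exists>y. DERIV Z s :> y \<and> y \<le> 0" by blast
    next
      show "continuous_on {0..T} Z"
        unfolding Z_def
        by (intro continuous_intros continuous_on_subset[OF contx]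
            continuous_on_compose2[OF matrix_vector_mult_linear_continuous_on, of _ _ UNIV]) auto
    qed
    then have "exp (2 * \<beta> * T) * (x T \<bullet> (P *v x T)) \<le> \<nu> * (norm (x 0))\<^sup>2"
      using \<nu>(2)[of "x 0"] by (simp add: Z_def)
    moreover have "exp (2 * \<beta> * T) * (\<mu> * (norm (x T))\<^sup>2) \<le> exp (2 * \<beta> * T) * (x T \<bullet> (P *v x T))"
      using \<mu>(2) by (intro mult_left_mono) auto
    ultimately have "exp (2 * \<beta> * T) * (\<mu> * (norm (x T))\<^sup>2) \<le> \<nu> * (norm (x 0))\<^sup>2"
      by linarith
    moreover have "exp (2 * \<beta> * T) = (exp (\<beta> * T))\<^sup>2"
      by (simp add: mult.assoc flip: exp_double)
    ultimately have "\<mu> * (exp (\<beta> * T) * norm (x T))\<^sup>2 \<le> \<nu> * (norm (x 0))\<^sup>2"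
      by (simp add: power_mult_distrib mult.left_commute)
    then have "(exp (\<beta> * T) * norm (x T))\<^sup>2 \<le> (sqrt (\<nu> / \<mu>) * norm (x 0))\<^sup>2"
      using \<mu>(1) \<nu>(1) by (simp add: power_mult_distrib field_simps)
    then have "exp (\<beta> * T) * norm (x T) \<le> sqrt (\<nu> / \<mu>) * norm (x 0)"
      by (rule power2_le_imp_le) (use \<mu>(1) \<nu>(1) in simp)
    then show ?thesis by (simp add: exp_minus field_simps)
  qed
  have inside: "norm (x s) < \<delta>" if s: "s \<ge> 0" for s
  proof (rule ccontr)
    assume "\<not> norm (x s) < \<delta>"
    \<comment> \<open>Times up to \<open>s\<close> at which the trajectory is not in the open ball;
      the least of them is the first exit time.\<close>
    define K where "K = {0..s} \<inter> (\<lambda>s. norm (x s)) -` {\<delta>..}"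
    have cont: "continuous_on {0..s} (\<lambda>s. norm (x s))"
      by (intro continuous_intros continuous_on_subset[OF contx]) auto
    have "closed K"
      unfolding K_def by (rule continuous_closed_preimage[OF cont]) auto
    moreover have "bounded K" unfolding K_def by (rule bounded_subset[of "{0..s}"]) auto
    moreover have "s \<in> K" using s \<open>\<not> norm (x s) < \<delta>\<close> by (simp add: K_def)
    ultimately obtain T where T: "T \<in> K" and least: "\<And>u. u \<in> K \<Longrightarrow> T \<le> u"
      using compact_attains_inf[of K] by (auto simp: compact_eq_bounded_closed)
    then have T': "0 \<le> T" "T \<le> s" "\<delta> \<le> norm (x T)" by (auto simp: K_def)
    \<comment> \<open>The intermediate value theorem and minimality put the trajectory exactly on
      the sphere at time \<open>T\<close>, hence in the closed ball until then. The decay bound at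
      \<open>T\<close> is then below \<open>\<delta>\<close>, a contradiction.\<close>
    obtain u where u: "0 \<le> u" "u \<le> T" "norm (x u) = \<delta>"
      using IVT'[of "\<lambda>s. norm (x s)" 0 \<delta> T] x0(1) T' continuous_on_subset[OF cont] by auto
    with least[of u] T' have "u = T" by (auto simp: K_def)
    with u have xT: "norm (x T) = \<delta>" by simp
    have "norm (x v) \<le> \<delta>" if "0 \<le> v" "v \<le> T" for v
    proof (cases "v \<in> K")
      case True
      then show ?thesis using least[of v] that xT by simp
    next
      case False
      then show ?thesis using that T'(2) by (simp add: K_def)
    qed
    with decay_while[OF T'(1)] xT
    have "\<delta> \<le> sqrt (\<nu> / \<mu>) * norm (x 0) * exp (- \<beta> * T)" by simp
    also have "\<dots> \<le> sqrt (\<nu> / \<mu>) * norm (x 0) * 1"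
      using \<beta> T' \<mu>(1) \<nu>(1) by (intro mult_left_mono) auto
    finally show False using x0(2) by simp
  qed
  show "norm (x t) < \<delta>" using inside[OF t] .
  show "norm (x t) \<le> sqrt (\<nu> / \<mu>) * norm (x 0) * exp (- \<beta> * t)"
    by (rule decay_while[OF t]) (use inside in \<open>auto intro: less_imp_le\<close>)
qed

section \<open>The closed-loop field and its linearization\<close>

lemma riccati_closed_loop_dissipation:
  fixes A Q P :: "real^'n^'n" and B :: "real^'m^'n" and D :: "real^'m^'m"
  assumes ric: "riccati_equation A B Q D P" and P: "transpose P = P" and D: "pos_def D"
  shows "y \<bullet> (P *v ((A - B ** matrix_inv D ** transpose B ** P) *v y)) \<le> - (y \<bullet> (Q *v y)) / 2"
proof -
  \<comment> \<open>The control term. The Riccati form at \<open>y\<close> gives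
    \<open>2 * (y \<bullet> (P *v (A *v y))) = z - y \<bullet> (Q *v y)\<close>; feedback subtracts
    a full \<open>z\<close>, leaving \<open>- (z + y \<bullet> (Q *v y)) / 2\<close>.\<close>
  define z where "z = y \<bullet> (P *v (B *v (matrix_inv D *v (transpose B *v (P *v y)))))"
  have z: "z = (transpose B *v (P *v y)) \<bullet> (matrix_inv D *v (transpose B *v (P *v y)))"
    using P unfolding z_def by (simp only: inner_matrix_vector_transpose)
  have "z \<ge> 0" unfolding z by (rule pos_def_inverse(2)[OF D])
  have "y \<bullet> ((transpose A ** P + P ** A - P ** B ** matrix_inv D ** transpose B ** P + Q) *v y) = 0"
    using ric by (simp add: riccati_equation_def)
  then have "y \<bullet> (transpose A *v (P *v y)) + y \<bullet> (P *v (A *v y)) - z + y \<bullet> (Q *v y) = 0"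
    unfolding z_def
    by (simp only: matrix_vector_mult_add_rdistrib matrix_vector_mult_diff_rdistrib
        inner_add_right inner_diff_right matrix_vector_mul_assoc matrix_mul_assoc)
  moreover have "y \<bullet> (transpose A *v (P *v y)) = y \<bullet> (P *v (A *v y))"
    using inner_matrix_vector_transpose[of y "transpose A" "P *v y"]
      inner_matrix_vector_transpose[of y P "A *v y"] P
    by (simp add: inner_commute del: transpose_matrix_vector)
  moreover have "y \<bullet> (P *v ((A - B ** matrix_inv D ** transpose B ** P) *v y)) = y \<bullet> (P *v (A *v y)) - z"
    unfolding z_def
    by (simp only: matrix_vector_mult_diff_rdistrib matrix_vector_mult_diff_distrib
        inner_diff_right matrix_vector_mul_assoc matrix_mul_assoc)
  ultimately show ?thesis using \<open>z \<ge> 0\<close> by argo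
qed

text \<open>At a critical point of \<open>V\<close> every product-rule term containing the
  derivative of \<open>g\<close> has a vanishing factor, so \<open>g\<close> enters only through its
  value at \<open>x\<close>.\<close>

lemma closed_loop_has_derivative:
  fixes f :: "real^'n \<Rightarrow> real^'n" and g :: "real^'n \<Rightarrow> real^'m^'n"
  assumes f: "f differentiable (at x)" and g: "g differentiable (at x)"
    and V: "grad V differentiable (at x)" and eq: "grad V x = 0"
  shows "((\<lambda>x. f x + g x *v feedback g D V x) has_derivative
    (\<lambda>h. (jacobian f (at x) - g x ** matrix_inv D ** transpose (g x) ** hessian V x) *v h)) (at x)"
proof -
  note bil = bounded_bilinear.FDERIV[OF bounded_bilinear_matrix_vector_mult]
  obtain g' where g': "(g has_derivative g') (at x)" using g by (auto simp: differentiable_def)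
  have df: "(f has_derivative (\<lambda>h. jacobian f (at x) *v h)) (at x)"
    using f by (simp add: jacobian_works)
  have dV: "(grad V has_derivative (\<lambda>h. hessian V x *v h)) (at x)"
    using V by (simp add: jacobian_works hessian_def)
  have "((\<lambda>x. transpose (g x) *v grad V x) has_derivative
      (\<lambda>h. transpose (g x) *v (hessian V x *v h) + transpose (g' h) *v grad V x)) (at x)"
    by (rule bil[OF bounded_linear.has_derivative[OF bounded_linear_transpose g'] dV])
  then have "((\<lambda>x. feedback g D V x) has_derivative
      (\<lambda>h. - (matrix_inv D *v (transpose (g x) *v (hessian V x *v h) + transpose (g' h) *v grad V x)))) (at x)"
    unfolding feedback_def
    by (intro has_derivative_minus bounded_linear.has_derivative[OF matrix_vector_mul_bounded_linear])
  from has_derivative_add[OF df bil[OF g' this]] show ?thesis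
    by (rule has_derivative_eq_rhs)
      (auto simp: feedback_def eq matrix_vector_mult_diff_rdistrib matrix_vector_mul_assoc[symmetric]
        linear_neg[OF matrix_vector_mul_linear] simp del: transpose_matrix_vector)
qed

lemma closed_loop_lipschitz_on_compact:
  fixes f :: "real^'n \<Rightarrow> real^'n" and g :: "real^'n \<Rightarrow> real^'m^'n"
  assumes "C2 f" "C2 g" "C2 V" and S: "compact S" "convex S"
  shows "\<exists>L. L-lipschitz_on S (\<lambda>x. f x + g x *v feedback g D V x)"
proof -
  note bil = bounded_bilinear.lipschitz_on_compact_prod[OF bounded_bilinear_matrix_vector_mult _ _ S(1)]
  note lin = bounded_linear.lipschitz_on_bounded_linear_compose
  have g: "\<exists>L. L-lipschitz_on S g" by (intro C2_lipschitz_on_compact assms)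
  have "\<exists>L. L-lipschitz_on S (\<lambda>x. feedback g D V x)"
    unfolding feedback_def
    by (intro lin[OF bounded_linear_minus[OF bounded_linear_ident]]
        lin[OF matrix_vector_mul_bounded_linear] bil lin[OF bounded_linear_transpose]
        g C2_grad_lipschitz_on_compact assms)
  then have "\<exists>L. L-lipschitz_on S (\<lambda>x. g x *v feedback g D V x)" by (rule bil[OF g])
  moreover have "\<exists>L. L-lipschitz_on S f" by (intro C2_lipschitz_on_compact assms)
  ultimately show ?thesis by (auto intro: lipschitz_on_add)
qed

text \<open>Composing with the metric projection onto a ball makes the vector field globally Lipschitz;
  the decay estimate keeps the resulting solution in the ball, where the field is unchanged.\<close>
lemma lyapunov_solution_exists:
  fixes H :: "real^'n \<Rightarrow> real^'n" and P :: "real^'n^'n"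
  assumes lip: "L-lipschitz_on (cball 0 \<delta>) H"
    and P: "transpose P = P"
    and \<mu>: "\<mu> > 0" "\<And>y. \<mu> * (norm y)\<^sup>2 \<le> y \<bullet> (P *v y)"
    and \<nu>: "\<nu> > 0" "\<And>y. y \<bullet> (P *v y) \<le> \<nu> * (norm y)\<^sup>2"
    and \<beta>: "\<beta> \<ge> 0"
    and decay: "\<And>y. norm y \<le> \<delta> \<Longrightarrow> y \<bullet> (P *v H y) \<le> - \<beta> * (y \<bullet> (P *v y))"
    and x0: "norm x0 < \<delta>" "sqrt (\<nu> / \<mu>) * norm x0 < \<delta>"
  obtains x where "x 0 = x0"
    and "\<And>t. t \<ge> 0 \<Longrightarrow> (x has_vector_derivative H (x t)) (at t within {0..})"
proof -
  let ?p = "closest_point (cball 0 \<delta>) :: real^'n \<Rightarrow> real^'n"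
  have \<delta>: "\<delta> \<ge> 0" using x0(1) norm_ge_zero[of x0] by linarith
  then have ne: "cball (0::real^'n) \<delta> \<noteq> {}" by simp
  have p: "?p y \<in> cball 0 \<delta>" for y by (rule closest_point_in_set[OF closed_cball ne])
  have pid: "?p y = y" if "norm y \<le> \<delta>" for y using that by (intro closest_point_self) simp
  have "1-lipschitz_on UNIV ?p"
    using closest_point_lipschitz[OF convex_cball closed_cball ne] by (intro lipschitz_onI) auto
  moreover have "L-lipschitz_on (range ?p) H"
    by (rule lipschitz_on_subset[OF lip]) (use p in blast)
  ultimately have "(L * 1)-lipschitz_on UNIV (\<lambda>y. H (?p y))" by (rule lipschitz_on_compose2)
  then obtain x where x: "x 0 = x0"
    and dx: "\<And>t. t \<ge> 0 \<Longrightarrow> (x has_vector_derivative H (?p (x t))) (at t within {0..})"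
    using lipschitz_ode_solution_exists by blast
  \<comment> \<open>The truncated field agrees with \<open>H\<close> on the closed ball, so it
    satisfies the same decay inequality there.\<close>
  have "norm (x t) < \<delta>" if "t \<ge> 0" for t
    by (rule lyapunov_exponential_decay(1)[OF P \<mu> \<nu> \<beta>, of \<delta> "\<lambda>y. H (?p y)"])
      (use dx that x x0 decay in \<open>auto simp: pid\<close>)
  then have "(x has_vector_derivative H (x t)) (at t within {0..})" if "t \<ge> 0" for t
    using dx[OF that] that by (simp add: pid less_imp_le)
  with x show thesis by (rule that)
qed

text \<open>The slack \<open>c - \<beta> * \<nu>\<close> between the dissipation of the linear part
  and the requested rate absorbs the first-order remainder near the origin.\<close>

lemma linearized_decay:
  fixes H :: "real^'n \<Rightarrow> real^'n" and P M :: "real^'n^'n"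
  assumes H: "(H has_derivative (\<lambda>h. M *v h)) (at 0)" and H0: "H 0 = 0"
    and M: "\<And>y. y \<bullet> (P *v (M *v y)) \<le> - c * (norm y)\<^sup>2"
    and \<nu>: "\<And>y. y \<bullet> (P *v y) \<le> \<nu> * (norm y)\<^sup>2"
    and \<beta>: "\<beta> \<ge> 0" "\<beta> * \<nu> < c" and P: "transpose P = P"
  obtains \<delta> where "\<delta> > 0"
    and "\<And>y. norm y \<le> \<delta> \<Longrightarrow> y \<bullet> (P *v H y) \<le> - \<beta> * (y \<bullet> (P *v y))"
proof -
  obtain K where K: "K > 0" "\<And>y. norm (P *v y) \<le> norm y * K"
    using bounded_linear.pos_bounded[OF matrix_vector_mul_bounded_linear, of P] by blast
  \<comment> \<open>Chosen so that the remainder, amplified by at most \<open>K\<close> through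
    \<open>P\<close>, uses up exactly the slack.\<close>
  define \<eta> where "\<eta> = (c - \<beta> * \<nu>) / K"
  have \<eta>: "\<eta> > 0" using \<beta> K by (simp add: \<eta>_def)
  then obtain d where d: "d > 0" "\<And>y. norm y < d \<Longrightarrow> norm (H y - M *v y) \<le> \<eta> * norm y"
    using H by (auto simp: has_derivative_at_alt H0)
  show thesis
  proof
    \<comment> \<open>Halving \<open>d\<close> passes from an estimate on an open ball to one on a
      closed ball.\<close>
    show "d / 2 > 0" using d by simp
    fix y :: "real^'n" assume y: "norm y \<le> d / 2"
    have "y \<bullet> (P *v (H y - M *v y)) = (P *v y) \<bullet> (H y - M *v y)"
      using P by (simp only: inner_matrix_vector_transpose)
    also have "\<dots> \<le> norm (P *v y) * norm (H y - M *v y)" by (rule norm_cauchy_schwarz)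
    also have "\<dots> \<le> (norm y * K) * (\<eta> * norm y)"
      using K d y by (intro mult_mono) auto
    also have "\<dots> = (c - \<beta> * \<nu>) * (norm y)\<^sup>2"
      using K by (simp add: \<eta>_def power2_eq_square)
    finally have "y \<bullet> (P *v H y) \<le> - (\<beta> * (\<nu> * (norm y)\<^sup>2))"
      using M[of y] by (simp add: matrix_vector_mult_diff_distrib inner_diff_right algebra_simps)
    also have "\<dots> \<le> - (\<beta> * (y \<bullet> (P *v y)))"
      using \<nu>[of y] \<beta> by (simp add: mult_left_mono)
    finally show "y \<bullet> (P *v H y) \<le> - \<beta> * (y \<bullet> (P *v y))" by simp
  qed
qed

text \<open>The asymptotic rate is expressed through \<open>\<epsilon>\<close>: the radius
  \<open>r\<close> may shrink with the permitted loss, while the overshoot \<open>\<alpha>\<close>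
  is fixed beforehand. Existence of a trajectory is asserted too, so that the bound on all
  trajectories is not vacuous.\<close>

theorem theorem3p20:
  fixes f :: "real^'n \<Rightarrow> real^'n"
    and g :: "real^'n \<Rightarrow> real^'m^'n"
    and q :: "real^'n \<Rightarrow> real"
    and D :: "real^'m^'m"
    and A Q P :: "real^'n^'n"
    and B :: "real^'m^'n"
    and V :: "real^'n \<Rightarrow> real"
    and c\<^sub>q r\<^sub>q :: real
  assumes smooth: "C2 f" "C2 g" "C2 q"
    and D: "pos_def D"
    and f0: "f 0 = 0"
    and q0: "q 0 = 0" and q_pos: "\<And>x. x \<noteq> 0 \<Longrightarrow> q x > 0"
    and A: "A = jacobian f (at 0)" and B: "B = g 0" and Q: "Q = hessian q 0"
    and stab: "stabilizable A B"
    and det: "detectable A (psd_sqrt Q)"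
    and P: "riccati_equation A B Q D P"
    and V_C2: "C2 V"
    and hjb: "\<forall>\<^sub>F x in nhds 0. hjb_inequality f g q D V x"
    and hess: "hessian V 0 = P" "pos_def P"
    and equil: "V 0 = 0" "grad V 0 = 0"
    and c\<^sub>q: "c\<^sub>q > 0" and r\<^sub>q: "r\<^sub>q > 0"
    and q_quad: "\<And>x. norm x < r\<^sub>q \<Longrightarrow> q x \<ge> c\<^sub>q * (norm x)\<^sup>2"
  shows "(\<forall>x. hjb_inequality f g q D V x \<longleftrightarrow> hjb_lmi f g q D V x) \<and>
    (\<exists>\<alpha>>0. \<forall>\<epsilon>>0. \<exists>\<beta>>0. \<exists>r>0.
       \<beta> \<ge> c\<^sub>q / lambda_max P - \<epsilon> \<and>
       (\<forall>x0. norm x0 < r \<longrightarrow>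
          (\<exists>x. closed_loop_trajectory f g (feedback g D V) x0 x) \<and>
          (\<forall>x. closed_loop_trajectory f g (feedback g D V) x0 x \<longrightarrow>
             (\<forall>t\<ge>0. norm (x t) \<le> \<alpha> * norm x0 * exp (- \<beta> * t)))))"
proof (intro conjI allI)
  show "hjb_inequality f g q D V x \<longleftrightarrow> hjb_lmi f g q D V x" for x
    by (rule hjb_inequality_iff_hjb_lmi[OF D])
next
  define F where "F x = f x + g x *v feedback g D V x" for x
  define M where "M = A - B ** matrix_inv D ** transpose B ** P"
  define \<nu> where "\<nu> = lambda_max P"
  have P_sym: "transpose P = P" using hess(2) by (simp add: pos_def_def)
  have upper: "y \<bullet> (P *v y) \<le> \<nu> * (norm y)\<^sup>2" for y
    unfolding \<nu>_def by (rule inner_le_lambda_max[OF P_sym])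
  obtain \<mu> where \<mu>: "\<mu> > 0" and lower: "\<And>y. \<mu> * (norm y)\<^sup>2 \<le> y \<bullet> (P *v y)"
    using pos_def_lower_bound[OF hess(2)] by blast
  \<comment> \<open>Both bounds are compared at a unit vector.\<close>
  have "\<mu> \<le> \<nu>" using order_trans[OF lower upper, of "axis undefined 1"] by simp
  with \<mu> have \<nu>: "\<nu> > 0" by simp
  \<comment> \<open>The half in the Riccati estimate cancels the factor 2 in the Hessian
    bound.\<close>
  have dissipation: "y \<bullet> (P *v (M *v y)) \<le> - c\<^sub>q * (norm y)\<^sup>2" for y
    using riccati_closed_loop_dissipation[OF P P_sym D, of y]
      hessian_lower_bound[OF smooth(3) q0 r\<^sub>q q_quad, of y]
    by (simp add: M_def Q)
  have "(F has_derivative (\<lambda>h. M *v h)) (at 0)"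
    unfolding F_def M_def A B hess(1)[symmetric]
    by (intro closed_loop_has_derivative C2_imp_differentiable smooth C2_grad_differentiable V_C2 equil)
  moreover have "F 0 = 0" by (simp add: F_def f0 feedback_def equil)
  ultimately have local_decay: "\<exists>\<delta>>0. \<forall>y. norm y \<le> \<delta> \<longrightarrow> y \<bullet> (P *v F y) \<le> - \<beta> * (y \<bullet> (P *v y))"
    if "\<beta> \<ge> 0" "\<beta> * \<nu> < c\<^sub>q" for \<beta>
    using linearized_decay[OF _ _ dissipation upper that P_sym] by metis
  define \<alpha> where "\<alpha> = sqrt (\<nu> / \<mu>)"
  have \<alpha>: "\<alpha> > 0" "\<alpha> \<ge> 1" using \<nu> \<mu> \<open>\<mu> \<le> \<nu>\<close> by (simp_all add: \<alpha>_def)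
  show "\<exists>\<alpha>>0. \<forall>\<epsilon>>0. \<exists>\<beta>>0. \<exists>r>0.
       \<beta> \<ge> c\<^sub>q / lambda_max P - \<epsilon> \<and>
       (\<forall>x0. norm x0 < r \<longrightarrow>
          (\<exists>x. closed_loop_trajectory f g (feedback g D V) x0 x) \<and>
          (\<forall>x. closed_loop_trajectory f g (feedback g D V) x0 x \<longrightarrow>
             (\<forall>t\<ge>0. norm (x t) \<le> \<alpha> * norm x0 * exp (- \<beta> * t))))"
  proof (rule exI[of _ \<alpha>], intro conjI allI impI)
    show "\<alpha> > 0" by (rule \<alpha>(1))
    fix \<epsilon> :: real assume "\<epsilon> > 0"
    \<comment> \<open>Capping the loss at half the limiting rate keeps \<open>\<beta>\<close>
      positive for large \<open>\<epsilon>\<close>; a positive loss keeps it strictly below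
      \<open>c\<^sub>q / \<nu>\<close>, as \<open>local_decay\<close> requires.\<close>
    define \<beta> where "\<beta> = c\<^sub>q / \<nu> - min \<epsilon> (c\<^sub>q / \<nu> / 2)"
    have pos: "c\<^sub>q / \<nu> > 0" using c\<^sub>q \<nu> by simp
    then have \<beta>: "\<beta> > 0" "\<beta> \<ge> c\<^sub>q / \<nu> - \<epsilon>" "\<beta> < c\<^sub>q / \<nu>"
      using \<open>\<epsilon> > 0\<close> by (auto simp: \<beta>_def)
    then have "\<beta> * \<nu> < c\<^sub>q" using \<nu> by (simp add: pos_less_divide_eq)
    with local_decay \<beta>(1) obtain \<delta> where \<delta>: "\<delta> > 0"
      and decay: "\<And>y. norm y \<le> \<delta> \<Longrightarrow> y \<bullet> (P *v F y) \<le> - \<beta> * (y \<bullet> (P *v y))"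
      by (meson less_imp_le)
    obtain L where L: "L-lipschitz_on (cball 0 \<delta>) F"
      using closed_loop_lipschitz_on_compact[OF smooth(1,2) V_C2 compact_cball convex_cball]
      unfolding F_def by blast
    have "(\<exists>x. closed_loop_trajectory f g (feedback g D V) x0 x) \<and>
        (\<forall>x. closed_loop_trajectory f g (feedback g D V) x0 x \<longrightarrow>
          (\<forall>t\<ge>0. norm (x t) \<le> \<alpha> * norm x0 * exp (- \<beta> * t)))"
      \<comment> \<open>Dividing by \<open>\<alpha>\<close> leaves room for the overshoot; since
        \<open>\<alpha> \<ge> 1\<close>, the initial state itself also lies in the ball.\<close>
      if x0: "norm x0 < \<delta> / \<alpha>" for x0
    proof -
      have small: "\<alpha> * norm x0 < \<delta>" using x0 \<alpha> by (simp add: pos_less_divide_eq mult.commute)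
      have "norm x0 \<le> \<alpha> * norm x0" using mult_right_mono[OF \<alpha>(2) norm_ge_zero[of x0]] by simp
      with small have small': "norm x0 < \<delta>" by simp
      obtain x where "closed_loop_trajectory f g (feedback g D V) x0 x"
        using lyapunov_solution_exists[OF L P_sym \<mu> lower \<nu> upper less_imp_le[OF \<beta>(1)] decay
            small' small[unfolded \<alpha>_def]]
        unfolding closed_loop_trajectory_def F_def by metis
      moreover have "norm (x t) \<le> \<alpha> * norm x0 * exp (- \<beta> * t)"
        if x: "closed_loop_trajectory f g (feedback g D V) x0 x" and t: "t \<ge> 0" for x t
      proof -
        have "x 0 = x0"
          and "\<And>s. s \<ge> 0 \<Longrightarrow> (x has_vector_derivative F (x s)) (at s within {0..})"
          using x by (simp_all add: closed_loop_trajectory_def F_def)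
        then show ?thesis
          using lyapunov_exponential_decay(2)[OF P_sym \<mu> lower \<nu> upper less_imp_le[OF \<beta>(1)] decay,
              of \<delta> x t] small small' t
          by (simp add: \<alpha>_def)
      qed
      ultimately show ?thesis by blast
    qed
    moreover have "\<delta> / \<alpha> > 0" using \<delta> \<alpha> by simp
    ultimately show "\<exists>\<beta>>0. \<exists>r>0. \<beta> \<ge> c\<^sub>q / lambda_max P - \<epsilon> \<and>
       (\<forall>x0. norm x0 < r \<longrightarrow>
          (\<exists>x. closed_loop_trajectory f g (feedback g D V) x0 x) \<and>
          (\<forall>x. closed_loop_trajectory f g (feedback g D V) x0 x \<longrightarrow>
             (\<forall>t\<ge>0. norm (x t) \<le> \<alpha> * norm x0 * exp (- \<beta> * t))))"
      using \<beta>(1,2) unfolding \<nu>_def by blast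
  qed
qed

end
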